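(* Let $k \geq 3$. Over the Boolean domain $\{0,1\}$ the following strict inclusions hold: (1) $\mathrm{Inv}(e_2) \subsetneq \mathrm{Inv}(e_k)$; (2) $\mathrm{Inv}(n_k) \subsetneq \mathrm{Inv}(e_k) \subsetneq \mathrm{Inv}(u_k)$; (3) $\mathrm{Inv}(n_k) \subsetneq \mathrm{Inv}(n_{k+1})$; (4) $\mathrm{Inv}(e_k) \subsetneq \mathrm{Inv}(e_{k+1})$; (5) $\mathrm{Inv}(u_k) \subsetneq \mathrm{Inv}(u_{k+1})$.
   Context: A $k$-ary partial operation on a set $D$ is a map $f: X \to D$ with $X = \mathrm{dom}(f) \subseteq D^k$. For tuples $t_1,\dots,t_k \in D^n$, $f(t_1,\dots,t_k)$ is computed coordinatewise, and is defined iff $(t_1[i],\dots,t_k[i]) \in \mathrm{dom}(f)$ for every $i \in [n]$. A relation $R \subseteq D^n$ is preserved by $f$ (equivalently, $f$ is a partial polymorphism of $R$) if for all $t_1,\dots,t_k \in R$ such that $f(t_1,\dots,t_k)$ is defined, $f(t_1,\dots,t_k) \in R$. $\mathrm{Inv}(f)$ denotes the set of all finitary relations over $D$ preserved by $f$. Partial $k$-NU operation $n_k$ ($k \geq 3$): the $k$-ary partial operation whose domain consists exactly of the tuples $(x,\dots,x,y,x,\dots,x)$ ($y$ in a single arbitrary position $i\in[k]$, $x,y \in D$), mapped to $x$. Partial $k$-edge operation $e_k$ ($k \geq 2$): the $(k+1)$-ary partial operation whose domain consists exactly of the tuples $(x,x,y,y,\dots,y)$ and $(x,y,x,y,\dots,y)$,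 and, for each $i \in \{4,\dots,k+1\}$, the tuples $(y,\dots,y,x,y,\dots,y)$ with $x$ in position $i$ (for all $x,y\in D$), each mapped to $y$. $k$-universal operation $u_k$ ($k\ge 2$): the Boolean partial operation of arity $2^k-1$ whose arguments are indexed by the nonzero vectors $v \in \{0,1\}^k\setminus\{0^k\}$; for $j \in [k]$ let $s_j$ be the tuple with $s_j[v] = v[j]$. Its domain consists of the two constant tuples, the $k$ tuples $s_j$ and their complements $\overline{s_j}$; $u_k(c,\dots,c)=c$, $u_k(s_j)=0$, $u_k(\overline{s_j})=1$. *)

theory Defs
  imports Main
begin

text \<open>
  The ground set of the operations and relations is the whole type \<open>'a\<close>, and the elements of
  the \<open>n\<close>-th power of the ground set are the lists of length \<open>n\<close>. Operations and relations carry
  their arity explicitly, so that empty relations of different arities are different.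
\<close>

type_synonym 'a partial_op = "nat \<times> ('a list \<rightharpoonup> 'a)"
type_synonym 'a frel = "nat \<times> 'a list set"

definition column :: "'a list list \<Rightarrow> nat \<Rightarrow> 'a list" where
  "column ts i = map (\<lambda>t. t ! i) ts"

definition app_defined :: "('a list \<rightharpoonup> 'a) \<Rightarrow> nat \<Rightarrow> 'a list list \<Rightarrow> bool" where
  "app_defined f n ts \<longleftrightarrow> (\<forall>i<n. column ts i \<in> dom f)"

definition app :: "('a list \<rightharpoonup> 'a) \<Rightarrow> nat \<Rightarrow> 'a list list \<Rightarrow> 'a list" where
  "app f n ts = map (\<lambda>i. the (f (column ts i))) [0..<n]"

definition preserved :: "'a partial_op \<Rightarrow> 'a frel \<Rightarrow> bool" where
  "preserved F A = (case (F, A) of ((k, f), (n, R)) \<Rightarrow>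
     \<forall>ts. length ts = k \<and> set ts \<subseteq> R \<and> app_defined f n ts \<longrightarrow> app f n ts \<in> R)"

definition Inv :: "'a partial_op \<Rightarrow> 'a frel set" where
  "Inv F = {(n, R). R \<subseteq> {t. length t = n} \<and> preserved F (n, R)}"

text \<open>The three operations are given by their graphs, which are functional by the lemmas below.\<close>

definition map_of_graph :: "('a \<times> 'b) set \<Rightarrow> 'a \<rightharpoonup> 'b" where
  "map_of_graph G x = (if \<exists>y. (x, y) \<in> G then Some (THE y. (x, y) \<in> G) else None)"

definition nu_graph :: "nat \<Rightarrow> ('a list \<times> 'a) set" where
  "nu_graph k = {((replicate k x)[i := y], x) | x y i. i < k}"

definition nu_op :: "nat \<Rightarrow> 'a partial_op" where
  "nu_op k = (k, map_of_graph (nu_graph k))"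

text \<open>List positions count from 0, so the positions 4 to \<open>k + 1\<close> become 3 to \<open>k\<close>.\<close>

definition edge_graph :: "nat \<Rightarrow> ('a list \<times> 'a) set" where
  "edge_graph k =
     {([x, x] @ replicate (k - 1) y, y) | x y. True} \<union>
     {([x, y, x] @ replicate (k - 2) y, y) | x y. True} \<union>
     {((replicate (k + 1) y)[i := x], y) | x y i. 3 \<le> i \<and> i \<le> k}"

definition edge_op :: "nat \<Rightarrow> 'a partial_op" where
  "edge_op k = (k + 1, map_of_graph (edge_graph k))"

text \<open>
  The nonzero Boolean vectors are listed in a fixed order, each exactly once, so that
  \<open>proj_tuple k j\<close> has the entry \<open>v ! j\<close> at the position of the vector \<open>v\<close>. The choice of
  the order does not affect the invariant relations.
\<close>

definition nonzero_vectors :: "nat \<Rightarrow> bool list list" where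
  "nonzero_vectors k = filter (\<lambda>v. v \<noteq> replicate k False) (List.n_lists k [False, True])"

definition proj_tuple :: "nat \<Rightarrow> nat \<Rightarrow> bool list" where
  "proj_tuple k j = map (\<lambda>v. v ! j) (nonzero_vectors k)"

definition univ_graph :: "nat \<Rightarrow> (bool list \<times> bool) set" where
  "univ_graph k =
     {(replicate (2 ^ k - 1) c, c) | c. True} \<union>
     {(proj_tuple k j, False) | j. j < k} \<union>
     {(map Not (proj_tuple k j), True) | j. j < k}"

definition univ_op :: "nat \<Rightarrow> bool partial_op" where
  "univ_op k = (2 ^ k - 1, map_of_graph (univ_graph k))"


lemma map_of_graph_eq_Some:
  assumes "single_valued G"
  shows "map_of_graph G x = Some y \<longleftrightarrow> (x, y) \<in> G"
proof -
  have "(THE z. (x, z) \<in> G) = y" if "(x, y) \<in> G" for y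
    using that assms by (auto simp: single_valued_def)
  then show ?thesis
    unfolding map_of_graph_def by auto
qed

lemma nonzero_vectors:
  "distinct (nonzero_vectors k)"
  "set (nonzero_vectors k) = {v. length v = k} - {replicate k False}"
  "length (nonzero_vectors k) = 2 ^ k - 1"
proof -
  show d: "distinct (nonzero_vectors k)"
    by (simp add: nonzero_vectors_def distinct_n_lists)
  have U: "{False, True} = UNIV" by auto
  show s: "set (nonzero_vectors k) = {v. length v = k} - {replicate k False}"
    by (auto simp: nonzero_vectors_def set_n_lists U)
  have "card {v :: bool list. length v = k} = 2 ^ k"
    using card_lists_length_eq[of "UNIV :: bool set" k] by simp
  moreover have "finite {v :: bool list. length v = k}"
    using finite_lists_length_eq[of "UNIV :: bool set" k] by simp
  ultimately show "length (nonzero_vectors k) = 2 ^ k - 1"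
    using distinct_card[OF d] by (simp add: s card_Diff_singleton)
qed

lemma nu_graph_length: "(t, z) \<in> nu_graph k \<Longrightarrow> length t = k"
  by (auto simp: nu_graph_def)

lemma edge_graph_length: "k \<ge> 2 \<Longrightarrow> (t, z) \<in> edge_graph k \<Longrightarrow> length t = k + 1"
  by (auto simp: edge_graph_def simp del: replicate.simps list_update.simps replicate_Suc)

lemma univ_graph_length: "(t, z) \<in> univ_graph k \<Longrightarrow> length t = 2 ^ k - 1"
  by (auto simp: univ_graph_def proj_tuple_def nonzero_vectors)

lemma single_valued_nu_graph:
  assumes "k \<ge> 3"
  shows "single_valued (nu_graph k :: ('a list \<times> 'a) set)"
proof -
  have "x = x'" if e: "(replicate k x)[i := y] = (replicate k x')[i' := y']"
    for x y x' y' :: 'a and i i'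
  proof -
    have "\<not> {0, 1, 2} \<subseteq> {i, i'}"
      by auto
    then obtain j where "j \<in> {0, 1, 2}" "j \<notin> {i, i'}" by blast
    then have "j < k" "j \<noteq> i" "j \<noteq> i'" using assms by auto
    then show ?thesis using arg_cong[OF e, of "\<lambda>t. t ! j"] by simp
  qed
  then show ?thesis by (fastforce simp: single_valued_def nu_graph_def)
qed

lemma single_valued_edge_graph:
  assumes "k \<ge> 2"
  shows "single_valued (edge_graph k :: ('a list \<times> 'a) set)"
proof -
  obtain m where k: "k = Suc (Suc m)" using assms by (metis add_2_eq_Suc le_Suc_ex)
  have sub: "t ! 2 = z \<and> t ! 0 = t ! 1 \<or> t ! 1 = z \<and> t ! 0 = t ! 2"
    if t: "(t, z) \<in> edge_graph k" for t and z :: 'a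
  proof -
    consider x where "t = [x, x] @ replicate (k - 1) z"
      | x where "t = [x, z, x] @ replicate (k - 2) z"
      | x i where "t = (replicate (k + 1) z)[i := x]" "3 \<le> i"
      using t unfolding edge_graph_def by blast
    then show ?thesis
    proof cases
      case 3
      have "t ! j = z" if "j < 3" for j
        using that 3 assms by (simp add: nth_list_update_neq del: replicate_Suc)
      then show ?thesis by simp
    qed (simp_all add: k)
  qed
  show ?thesis
    unfolding single_valued_def using sub by metis
qed

lemma single_valued_univ_graph:
  assumes "k \<ge> 2"
  shows "single_valued (univ_graph k)"
proof -
  have val: "proj_tuple k j ! p = nonzero_vectors k ! p ! j" 
    if "p < 2 ^ k - 1" for j p
    using that by (simp add: proj_tuple_def nonzero_vectors)
  have ones: "\<exists>p<2 ^ k - 1. \<forall>j<k. proj_tuple k j ! p"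
  proof -
    have "replicate k True \<in> set (nonzero_vectors k)"
      using assms by (auto simp: nonzero_vectors replicate_eq_replicate)
    then obtain p where "p < 2 ^ k - 1" "nonzero_vectors k ! p = replicate k True"
      by (metis in_set_conv_nth nonzero_vectors(3))
    then show ?thesis using val by auto
  qed
  have zero: "\<exists>p<2 ^ k - 1. \<not> proj_tuple k j ! p" if "j < k" for j
  proof -
    have "(replicate k True)[j := False] \<noteq> replicate k False"
    proof
      assume e: "(replicate k True)[j := False] = replicate k False"
      have "\<exists>i<k. i \<noteq> j"
        using assms by (cases "j = 0") (auto intro: exI[of _ 0] exI[of _ 1])
      then obtain i where "i < k" "i \<noteq> j" by blast
      then show False using arg_cong[OF e, of "\<lambda>t. t ! i"] by simp
    qed
    then have "(replicate k True)[j := False] \<in> set (nonzero_vectors k)"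
      by (auto simp: nonzero_vectors)
    then obtain p where "p < 2 ^ k - 1" "nonzero_vectors k ! p = (replicate k True)[j := False]"
      by (metis in_set_conv_nth nonzero_vectors(3))
    then show ?thesis using val that by auto
  qed
  have len: "length (proj_tuple k j) = 2 ^ k - 1" for j
    by (simp add: proj_tuple_def nonzero_vectors)
  obtain p where p: "p < 2 ^ k - 1" "\<And>j. j < k \<Longrightarrow> proj_tuple k j ! p"
    using ones by blast
  have c: "z = (t ! p \<longleftrightarrow> (\<forall>q<2 ^ k - 1. t ! q = t ! p))" if t: "(t, z) \<in> univ_graph k" for t z
  proof -
    consider "t = replicate (2 ^ k - 1) z"
      | j where "j < k" "t = proj_tuple k j" "\<not> z"
      | j where "j < k" "t = map Not (proj_tuple k j)" z
      using t unfolding univ_graph_def by blast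
    then show ?thesis
    proof cases
      case 1
      then show ?thesis using p(1) by simp
    next
      case (2 j)
      then show ?thesis using p(2)[of j] zero[of j] by auto
    next
      case (3 j)
      obtain q where q: "q < 2 ^ k - 1" "\<not> proj_tuple k j ! q" using zero[OF 3(1)] by blast
      have "t ! q" "\<not> t ! p" using q p 3 by (simp_all add: len)
      then show ?thesis using q(1) 3(3) by auto
    qed
  qed
  show ?thesis unfolding single_valued_def using c by metis
qed

end

theory Submission
  imports Defs
begin

text \<open>
  The inclusions are all obtained by identifying variables: the restriction of a tuple in the
  domain of the weaker operation to suitable positions lies in the domain of the stronger one.

  For the strictness, the relation of all nonzero Boolean \<open>k\<close>-tuples is preserved by the partial
  near-unanimity operation of arity \<open>k + 1\<close>, by the pigeonhole principle, but not by the
  \<open>k\<close>-universal operation. By the inclusions, this one relation settles every step from \<open>k\<close> to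
  \<open>k + 1\<close>. The tuples of odd weight separate the edge operations from the near-unanimity
  operations. The relation consisting of the unit vectors and the vector
  \<open>(1, 1, 0, \<dots>, 0)\<close> separates the universal from the edge operations: two columns that
  are projections to different coordinates (or complements of such) take all four pairs of
  values, which forces all nonconstant columns to depend on one common coordinate.
\<close>

section \<open>Preservation in terms of graphs, and identification of variables\<close>

text \<open>Since \<open>G\<close> is single-valued, the columns determine the result tuple;
  quantifying over candidates \<open>r\<close> therefore replaces definedness and
  application.\<close>

lemma Inv_graph_iff:
  assumes "single_valued G"
  shows "(n, R) \<in> Inv (m, map_of_graph G) \<longleftrightarrow> R \<subseteq> {t. length t = n} \<and>
    (\<forall>ts r. length ts = m \<and> set ts \<subseteq> R \<and> length r = n \<and>
      (\<forall>i<n. (column ts i, r ! i) \<in> G) \<longrightarrow> r \<in> R)"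
proof -
  have eq: "length r = n \<and> (\<forall>i<n. (column ts i, r ! i) \<in> G) \<longleftrightarrow>
      app_defined (map_of_graph G) n ts \<and> r = app (map_of_graph G) n ts" for ts r
    unfolding app_defined_def app_def list_eq_iff_nth_eq
    by (auto simp: map_of_graph_eq_Some[OF assms, symmetric] dom_def)
  show ?thesis
    unfolding Inv_def preserved_def using eq by auto
qed

text \<open>Selecting the rows \<open>\<sigma> p\<close> turns a matrix with \<open>l\<close> rows
  into one with \<open>m\<close> rows. By \<open>minor\<close>, each shortened column keeps its
  value, so both operations produce the same result tuple.\<close>

lemma Inv_minor_subset:
  assumes G: "single_valued G" and H: "single_valued H"
    and len: "\<And>t z. (t, z) \<in> H \<Longrightarrow> length t = l"
    and \<sigma>: "\<And>p. p < m \<Longrightarrow> \<sigma> p < l"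
    and minor: "\<And>t z. (t, z) \<in> H \<Longrightarrow> (map (\<lambda>p. t ! \<sigma> p) [0..<m], z) \<in> G"
  shows "Inv (m, map_of_graph G) \<subseteq> Inv (l, map_of_graph H)"
proof
  fix A assume A: "A \<in> Inv (m, map_of_graph G)"
  obtain n R where nR: "A = (n, R)" by (cases A)
  have "r \<in> R" if ts: "length ts = l" "set ts \<subseteq> R" and r: "length r = n"
    "\<And>i. i < n \<Longrightarrow> (column ts i, r ! i) \<in> H" for ts r
  proof -
    define us where "us = map (\<lambda>p. ts ! \<sigma> p) [0..<m]"
    have "set us \<subseteq> R" using ts \<sigma> by (auto simp: us_def)
    moreover have "(column us i, r ! i) \<in> G" if "i < n" for i
    proof -
      have "column us i = map (\<lambda>p. column ts i ! \<sigma> p) [0..<m]"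
        using ts \<sigma> by (auto simp: us_def column_def)
      then show ?thesis using minor[OF r(2)[OF that]] by simp
    qed
    moreover have "length us = m" by (simp add: us_def)
    ultimately show ?thesis
      using A r(1) unfolding nR Inv_graph_iff[OF G] by blast
  qed
  then show "A \<in> Inv (l, map_of_graph H)"
    using A unfolding nR Inv_graph_iff[OF G] Inv_graph_iff[OF H] by blast
qed

section \<open>Coordinatewise descriptions of the graphs\<close>

lemma nu_graph_iff:
  "(t, z) \<in> nu_graph k \<longleftrightarrow> length t = k \<and> (\<exists>i<k. \<forall>p<k. p \<noteq> i \<longrightarrow> t ! p = z)"
proof
  assume "length t = k \<and> (\<exists>i<k. \<forall>p<k. p \<noteq> i \<longrightarrow> t ! p = z)"
  then obtain i where i: "length t = k" "i < k" "\<forall>p<k. p \<noteq> i \<longrightarrow> t ! p = z" by blast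
  then have "t = (replicate k z)[i := t ! i]"
    by (auto simp: list_eq_iff_nth_eq nth_list_update)
  then show "(t, z) \<in> nu_graph k" using i(2) unfolding nu_graph_def by blast
qed (auto simp: nu_graph_def)

text \<open>The three families merge into one pattern per index \<open>i < k\<close>:
  \<open>x\<close> stands at position \<open>i + 1\<close>, and for \<open>i = 0\<close> and
  \<open>i = 1\<close> also at position 0.\<close>

lemma edge_graph_iff:
  assumes "k \<ge> 2"
  shows "(t, z) \<in> edge_graph k \<longleftrightarrow> length t = k + 1 \<and>
    (\<exists>x. \<exists>i<k. \<forall>p<k + 1. t ! p = (if p = 0 \<and> i < 2 \<or> p = i + 1 then x else z))"
    (is "_ \<longleftrightarrow> length t = k + 1 \<and> (\<exists>x. \<exists>i<k. ?row x i)")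
proof -
  obtain m where k: "k = Suc (Suc m)" using assms by (metis add_2_eq_Suc le_Suc_ex)
  have nth3: "([a, b, c] @ replicate m z) ! p = (if p = 0 then a else if p = 1 then b
      else if p = 2 then c else z)" if "p < k + 1" for a b c p
    using that k by (auto simp: nth_Cons' nth_append)
  have r1: "[x, x] @ replicate (k - 1) z = [x, x, z] @ replicate m z" for x
    by (simp add: k)
  have r2: "[x, z, x] @ replicate (k - 2) z = [x, z, x] @ replicate m z" for x
    by (simp add: k)
  have c1: "t = [x, x] @ replicate (k - 1) z \<longleftrightarrow> length t = k + 1 \<and> ?row x 0" for x
    unfolding r1 list_eq_iff_nth_eq using nth3 by (auto simp: k)
  have c2: "t = [x, z, x] @ replicate (k - 2) z \<longleftrightarrow> length t = k + 1 \<and> ?row x 1" for x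
    unfolding r2 list_eq_iff_nth_eq using nth3 by (auto simp: k numeral_2_eq_2)
  have c3: "t = (replicate (k + 1) z)[i + 1 := x] \<longleftrightarrow> length t = k + 1 \<and> ?row x i"
    if "2 \<le> i" "i < k" for x i
    unfolding list_eq_iff_nth_eq using that
    by (auto simp: nth_list_update simp del: replicate_Suc)
  have "(t, z) \<in> edge_graph k \<longleftrightarrow> (\<exists>x. t = [x, x] @ replicate (k - 1) z) \<or>
      (\<exists>x. t = [x, z, x] @ replicate (k - 2) z) \<or>
      (\<exists>x i. 3 \<le> i \<and> i \<le> k \<and> t = (replicate (k + 1) z)[i := x])"
    unfolding edge_graph_def by blast
  also have "(\<exists>x i. 3 \<le> i \<and> i \<le> k \<and> t = (replicate (k + 1) z)[i := x]) \<longleftrightarrow>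
      (\<exists>x i. 2 \<le> i \<and> i < k \<and> t = (replicate (k + 1) z)[i + 1 := x])"
  proof -
    have shift: "(\<exists>i. 3 \<le> i \<and> i \<le> k \<and> P i) \<longleftrightarrow> (\<exists>i. 2 \<le> i \<and> i < k \<and> P (i + 1))" for P
    proof
      assume "\<exists>i. 3 \<le> i \<and> i \<le> k \<and> P i"
      then obtain i where "3 \<le> i" "i \<le> k" "P i" by blast
      then show "\<exists>i. 2 \<le> i \<and> i < k \<and> P (i + 1)" by (intro exI[of _ "i - 1"]) auto
    next
      assume "\<exists>i. 2 \<le> i \<and> i < k \<and> P (i + 1)"
      then obtain i where "2 \<le> i" "i < k" "P (i + 1)" by blast
      then show "\<exists>i. 3 \<le> i \<and> i \<le> k \<and> P i" by (intro exI[of _ "i + 1"]) auto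
    qed
    show ?thesis by (rule arg_cong[where f = Ex], rule ext, rule shift)
  qed
  also have "(\<exists>x. t = [x, x] @ replicate (k - 1) z) \<or>
      (\<exists>x. t = [x, z, x] @ replicate (k - 2) z) \<or>
      (\<exists>x i. 2 \<le> i \<and> i < k \<and> t = (replicate (k + 1) z)[i + 1 := x]) \<longleftrightarrow>
      length t = k + 1 \<and> (\<exists>x. ?row x 0 \<or> ?row x 1 \<or> (\<exists>i. 2 \<le> i \<and> i < k \<and> ?row x i))"
    unfolding c1 c2 using c3 by blast
  also have "(\<exists>x. ?row x 0 \<or> ?row x 1 \<or> (\<exists>i. 2 \<le> i \<and> i < k \<and> ?row x i)) \<longleftrightarrow>
      (\<exists>x. \<exists>i<k. ?row x i)"
  proof -
    have split: "Q 0 \<or> Q 1 \<or> (\<exists>i. 2 \<le> i \<and> i < k \<and> Q i) \<longleftrightarrow> (\<exists>i<k. Q i)" for Q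
    proof
      assume "\<exists>i<k. Q i"
      then obtain i where i: "i < k" "Q i" by blast
      consider "i = 0" | "i = 1" | "2 \<le> i" by linarith
      then show "Q 0 \<or> Q 1 \<or> (\<exists>i. 2 \<le> i \<and> i < k \<and> Q i)"
        using i by cases auto
    next
      assume "Q 0 \<or> Q 1 \<or> (\<exists>i. 2 \<le> i \<and> i < k \<and> Q i)"
      moreover have "0 < k" "1 < k" using assms by auto
      ultimately show "\<exists>i<k. Q i" by blast
    qed
    show ?thesis by (rule arg_cong[where f = Ex], rule ext, rule split)
  qed
  finally show ?thesis .
qed

section \<open>Inclusions\<close>

lemma Inv_nu_subset_Inv_nu_Suc:
  assumes "k \<ge> 3"
  shows "Inv (nu_op k :: 'a partial_op) \<subseteq> Inv (nu_op (k + 1))"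
  unfolding nu_op_def
proof (rule Inv_minor_subset[where \<sigma> = id])
  fix t :: "'a list" and z assume "(t, z) \<in> nu_graph (k + 1)"
  then obtain i where i: "i < k + 1" "\<And>p. p < k + 1 \<Longrightarrow> p \<noteq> i \<Longrightarrow> t ! p = z"
    unfolding nu_graph_iff by blast
  \<comment> \<open>If the deviating position is the dropped last one, the rest is constant and
    position 0 can be named instead.\<close>
  then have "\<exists>j<k. \<forall>p<k. p \<noteq> j \<longrightarrow> t ! p = z"
    using assms by (intro exI[of _ "if i < k then i else 0"]) auto
  then show "(map (\<lambda>p. t ! id p) [0..<k], z) \<in> nu_graph k"
    unfolding nu_graph_iff by simp
qed (use assms in \<open>auto simp: single_valued_nu_graph nu_graph_length\<close>)

lemma Inv_edge_subset_Inv_edge_Suc: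
  assumes "k \<ge> 2"
  shows "Inv (edge_op k :: 'a partial_op) \<subseteq> Inv (edge_op (k + 1))"
  unfolding edge_op_def
proof (rule Inv_minor_subset[where \<sigma> = id])
  fix t :: "'a list" and z assume "(t, z) \<in> edge_graph (k + 1)"
  then obtain x i where i: "i < k + 1" "\<And>p. p < k + 2 \<Longrightarrow>
      t ! p = (if p = 0 \<and> i < 2 \<or> p = i + 1 then x else z)"
    using assms by (auto simp: edge_graph_iff)
  have "\<exists>x. \<exists>j<k. \<forall>p<k + 1. t ! p = (if p = 0 \<and> j < 2 \<or> p = j + 1 then x else z)"
  proof (cases "i < k")
    case False
    \<comment> \<open>Here \<open>i = k\<close>, so all remaining entries equal \<open>z\<close>,
      which is the pattern of index 0 with \<open>x = z\<close>.\<close>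
    then show ?thesis using i assms by (intro exI[of _ z] exI[of _ 0]) auto
  qed (use i in \<open>auto intro!: exI[of _ x] exI[of _ i]\<close>)
  then show "(map (\<lambda>p. t ! id p) [0..<k + 1], z) \<in> edge_graph k"
    using assms by (simp add: edge_graph_iff nth_append del: upt_Suc)
qed (use assms in \<open>auto simp: single_valued_edge_graph dest: edge_graph_length[rotated]\<close>)

lemma Inv_edge_mono:
  assumes "2 \<le> k" "k \<le> l"
  shows "Inv (edge_op k :: 'a partial_op) \<subseteq> Inv (edge_op l)"
  using assms(2)
proof (induction l rule: dec_induct)
  case (step l)
  then show ?case using Inv_edge_subset_Inv_edge_Suc[of l, where ?'a = 'a] assms(1) by auto
qed simp

text \<open>Dropping argument 0 leaves at most one deviating entry, which is a near-unanimity
  tuple.\<close>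

lemma Inv_nu_subset_Inv_edge:
  assumes "k \<ge> 3"
  shows "Inv (nu_op k :: 'a partial_op) \<subseteq> Inv (edge_op k)"
  unfolding nu_op_def edge_op_def
proof (rule Inv_minor_subset[where \<sigma> = Suc])
  fix t :: "'a list" and z assume "(t, z) \<in> edge_graph k"
  then show "(map (\<lambda>p. t ! Suc p) [0..<k], z) \<in> nu_graph k"
    using assms by (auto simp: edge_graph_iff nu_graph_iff)
qed (use assms in \<open>auto simp: single_valued_edge_graph single_valued_nu_graph
       dest: edge_graph_length[rotated]\<close>)

section \<open>Identification of variables in the universal operation\<close>

text \<open>On Booleans \<open>\<noteq>\<close> is exclusive or: \<open>b = False\<close> gives the
  projection tuple and \<open>b = True\<close> its complement, so both become one case with value
  \<open>b\<close>.\<close>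

lemma univ_graph_cases:
  assumes "(t, z) \<in> univ_graph k"
  obtains (const) "t = replicate (2 ^ k - 1) z"
    | (proj) b j where "j < k" "z = b" "t = map (\<lambda>v. v ! j \<noteq> b) (nonzero_vectors k)"
  using assms unfolding univ_graph_def proj_tuple_def
  by (fastforce simp: comp_def)

lemma nonzero_vector_position:
  assumes "length v = k" "i < k" "v ! i"
  obtains p where "p < 2 ^ k - 1" "nonzero_vectors k ! p = v"
proof -
  have "v \<noteq> replicate k False" using assms by (metis nth_replicate)
  then have "v \<in> set (nonzero_vectors k)"
    using assms by (simp add: nonzero_vectors)
  then show ?thesis using that by (metis in_set_conv_nth nonzero_vectors(3))
qed

text \<open>Each nonzero vector \<open>w p\<close> indexes an argument of the universal operation.
  Restricting the projection to coordinate \<open>j\<close> to these arguments yields the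
  \<open>j\<close>-th coordinates of the vectors \<open>w p\<close>.\<close>

lemma Inv_minor_univ:
  assumes G: "single_valued G" and k: "k \<ge> 2"
    and w: "\<And>p. p < m \<Longrightarrow> length (w p) = k \<and> (\<exists>i<k. w p ! i)"
    and const: "\<And>z. (replicate m z, z) \<in> G"
    and proj: "\<And>j b. j < k \<Longrightarrow> (map (\<lambda>p. w p ! j \<noteq> b) [0..<m], b) \<in> G"
  shows "Inv (m, map_of_graph G) \<subseteq> Inv (univ_op k)"
proof -
  have "\<exists>q<2 ^ k - 1. nonzero_vectors k ! q = w p" if "p < m" for p
    using w[OF that] nonzero_vector_position by metis
  then obtain \<sigma> where \<sigma>: "\<And>p. p < m \<Longrightarrow> \<sigma> p < 2 ^ k - 1 \<and> nonzero_vectors k ! \<sigma> p = w p"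
    by metis
  show ?thesis unfolding univ_op_def
  proof (rule Inv_minor_subset[where \<sigma> = \<sigma>])
    fix t z assume "(t, z) \<in> univ_graph k"
    then show "(map (\<lambda>p. t ! \<sigma> p) [0..<m], z) \<in> G"
    proof (cases rule: univ_graph_cases)
      case const
      then have "map (\<lambda>p. t ! \<sigma> p) [0..<m] = replicate m z"
        using \<sigma> by (auto simp: list_eq_iff_nth_eq)
      then show ?thesis using assms(4) by simp
    next
      case (proj b j)
      then have eq: "map (\<lambda>p. t ! \<sigma> p) [0..<m] = map (\<lambda>p. w p ! j \<noteq> b) [0..<m]"
        using \<sigma> by (auto simp: nonzero_vectors)
      show ?thesis unfolding eq proj(2) by (rule assms(5)[OF proj(1)])
    qed
  qed (use \<sigma> in \<open>auto simp: G k single_valued_univ_graph univ_graph_length\<close>)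
qed

lemma Inv_edge_subset_Inv_univ:
  assumes "k \<ge> 2"
  shows "Inv (edge_op k) \<subseteq> Inv (univ_op k)"
  unfolding edge_op_def
\<comment> \<open>Vector 0 is (1, 1, 0, ..., 0) and vector \<open>p > 0\<close> is the unit vector
  at \<open>p - 1\<close>. Their \<open>j\<close>-th coordinates form the edge pattern of index
  \<open>j\<close>.\<close>
proof (rule Inv_minor_univ[where w = "\<lambda>p. map (\<lambda>j. p = 0 \<and> j < 2 \<or> p = j + 1) [0..<k]"])
  fix p assume p: "p < k + 1"
  show "length (map (\<lambda>j. p = 0 \<and> j < 2 \<or> p = j + 1) [0..<k]) = k \<and>
      (\<exists>i<k. map (\<lambda>j. p = 0 \<and> j < 2 \<or> p = j + 1) [0..<k] ! i)"
    \<comment> \<open>For \<open>p = 0\<close> truncated subtraction yields coordinate 0, where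
      vector 0 is indeed one.\<close>
    using p assms by (auto intro!: exI[of _ "p - 1"])
next
  show "(replicate (k + 1) z, z) \<in> edge_graph k" for z :: bool
    using assms unfolding edge_graph_iff[OF assms]
    by (auto intro!: exI[of _ z] exI[of _ 0] simp del: replicate_Suc)
next
  fix j b assume j: "j < k"
  then show "(map (\<lambda>p. map (\<lambda>j. p = 0 \<and> j < 2 \<or> p = j + 1) [0..<k] ! j \<noteq> b) [0..<k + 1], b)
      \<in> edge_graph k"
    unfolding edge_graph_iff[OF assms]
    by (auto intro!: exI[of _ "\<not> b"] exI[of _ j] simp del: upt_Suc)
qed (use assms in \<open>auto simp: single_valued_edge_graph\<close>)

lemma univ_graph_const: "(replicate (2 ^ k - 1) z, z) \<in> univ_graph k"
  unfolding univ_graph_def by auto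

lemma univ_graph_proj:
  assumes "j < k"
  shows "(map (\<lambda>v. v ! j \<noteq> b) (nonzero_vectors k), b) \<in> univ_graph k"
  using assms unfolding univ_graph_def proj_tuple_def by (cases b) (auto simp: comp_def)

text \<open>Each nonzero vector is extended by a zero: the first \<open>k\<close> projections stay
  projections, and the last one becomes a constant tuple.\<close>

lemma Inv_univ_subset_Inv_univ_Suc:
  assumes "k \<ge> 2"
  shows "Inv (univ_op k) \<subseteq> Inv (univ_op (k + 1))"
proof -
  have len: "length (nonzero_vectors k ! p) = k \<and> (\<exists>i<k. nonzero_vectors k ! p ! i)"
    if "p < 2 ^ k - 1" for p
  proof -
    have "nonzero_vectors k ! p \<in> set (nonzero_vectors k)"
      using that by (simp add: nonzero_vectors(3))
    then show ?thesis by (auto simp: nonzero_vectors(2) list_eq_iff_nth_eq)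
  qed
  show ?thesis
    unfolding univ_op_def[of k]
  proof (rule Inv_minor_univ[where w = "\<lambda>p. nonzero_vectors k ! p @ [False]"])
    show "length (nonzero_vectors k ! p @ [False]) = k + 1 \<and>
        (\<exists>i<k + 1. (nonzero_vectors k ! p @ [False]) ! i)" if p: "p < 2 ^ k - 1" for p
    proof -
      obtain i where "i < k" "nonzero_vectors k ! p ! i" using len[OF p] by blast
      then show ?thesis using len[OF p] by (auto simp: nth_append intro!: exI[of _ i])
    qed
  next
    fix j b assume j: "j < k + 1"
    show "(map (\<lambda>p. (nonzero_vectors k ! p @ [False]) ! j \<noteq> b) [0..<2 ^ k - 1], b) \<in> univ_graph k"
    proof (cases "j < k")
      case True
      then have "map (\<lambda>p. (nonzero_vectors k ! p @ [False]) ! j \<noteq> b) [0..<2 ^ k - 1] =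
          map (\<lambda>v. v ! j \<noteq> b) (nonzero_vectors k)"
        using len by (auto simp: list_eq_iff_nth_eq nonzero_vectors(3) nth_append)
      then show ?thesis using univ_graph_proj[OF True] by simp
    next
      case False
      then have "map (\<lambda>p. (nonzero_vectors k ! p @ [False]) ! j \<noteq> b) [0..<2 ^ k - 1] =
          replicate (2 ^ k - 1) b"
        using len j by (auto simp: list_eq_iff_nth_eq nth_append)
      then show ?thesis using univ_graph_const by simp
    qed
  qed (use assms in \<open>simp_all only: single_valued_univ_graph univ_graph_const trans_le_add1\<close>)
qed

section \<open>Separating relations\<close>

definition nonzero_tuples :: "nat \<Rightarrow> bool list set" where
  "nonzero_tuples k = {t. length t = k \<and> (\<exists>i<k. t ! i)}"

lemma nonzero_tuples_in_Inv_nu: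
  assumes "k \<ge> 2"
  shows "(k, nonzero_tuples k) \<in> Inv (nu_op (k + 1))"
proof -
  have sv: "single_valued (nu_graph (k + 1) :: (bool list \<times> bool) set)"
    using assms by (intro single_valued_nu_graph) simp
  have "r \<in> nonzero_tuples k"
    if ts: "length ts = k + 1" "set ts \<subseteq> nonzero_tuples k" and r: "length r = k"
      "\<And>i. i < k \<Longrightarrow> (column ts i, r ! i) \<in> nu_graph (k + 1)" for ts r
  proof (rule ccontr)
    assume "r \<notin> nonzero_tuples k"
    then have z: "\<not> r ! i" if "i < k" for i using that r(1) by (auto simp: nonzero_tuples_def)
    have "\<exists>i<k. ts ! p ! i" if "p < k + 1" for p
    proof -
      have "ts ! p \<in> nonzero_tuples k" using ts that nth_mem[of p ts] by auto
      then show ?thesis by (simp add: nonzero_tuples_def)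
    qed
    then obtain f where f: "\<And>p. p < k + 1 \<Longrightarrow> f p < k \<and> ts ! p ! f p" by metis
    \<comment> \<open>\<open>f\<close> picks a one in every row. A column with value
      \<open>False\<close> contains at most one \<open>True\<close>, so distinct rows pick distinct
      coordinates.\<close>
    have "inj_on f {..<k + 1}"
    proof (rule inj_onI)
      fix p q assume pq: "p \<in> {..<k + 1}" "q \<in> {..<k + 1}" "f p = f q"
      then have "(column ts (f p), False) \<in> nu_graph (k + 1)"
        using r(2)[of "f p"] f[of p] z[of "f p"] by simp
      then obtain i where "\<And>s. s < k + 1 \<Longrightarrow> s \<noteq> i \<Longrightarrow> \<not> column ts (f p) ! s"
        unfolding nu_graph_iff by auto
      then have "\<And>s. s < k + 1 \<Longrightarrow> s \<noteq> i \<Longrightarrow> \<not> ts ! s ! f p"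
        using ts(1) by (simp add: column_def)
      then show "p = q" using f pq by (metis lessThan_iff)
    qed
    moreover have "f ` {..<k + 1} \<subseteq> {..<k}" using f by auto
    ultimately have "card {..<k + 1} \<le> card {..<k}" by (intro card_inj_on_le) auto
    then show False by simp
  qed
  then show ?thesis
    unfolding nu_op_def Inv_graph_iff[OF sv] by (auto simp: nonzero_tuples_def)
qed

text \<open>With all nonzero vectors as rows, in their listed order, column \<open>i\<close> is the
  \<open>i\<close>-th projection tuple and is sent to \<open>False\<close>; the result is the zero
  tuple.\<close>

lemma nonzero_tuples_notin_Inv_univ:
  assumes "k \<ge> 2"
  shows "(k, nonzero_tuples k) \<notin> Inv (univ_op k)"
proof
  assume "(k, nonzero_tuples k) \<in> Inv (univ_op k)"
  then have *: "\<And>ts r. length ts = 2 ^ k - 1 \<Longrightarrow> set ts \<subseteq> nonzero_tuples k \<Longrightarrow> length r = k \<Longrightarrow>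
      (\<And>i. i < k \<Longrightarrow> (column ts i, r ! i) \<in> univ_graph k) \<Longrightarrow> r \<in> nonzero_tuples k"
    unfolding univ_op_def Inv_graph_iff[OF single_valued_univ_graph[OF assms]] by blast
  have "replicate k False \<in> nonzero_tuples k"
  proof (rule *)
    show "set (nonzero_vectors k) \<subseteq> nonzero_tuples k"
      by (auto simp: nonzero_vectors nonzero_tuples_def list_eq_iff_nth_eq)
    show "(column (nonzero_vectors k) i, replicate k False ! i) \<in> univ_graph k" if "i < k" for i
      using that univ_graph_proj[OF that, of False] by (simp add: column_def)
  qed (simp_all add: nonzero_vectors)
  then show False by (auto simp: nonzero_tuples_def)
qed

section \<open>Tuples of odd weight: an affine equation over the two-element field\<close>

definition odd_tuples :: "nat \<Rightarrow> bool list set" where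
  "odd_tuples k = {t. length t = k \<and> odd (\<Sum>i<k. of_bool (t ! i) :: nat)}"

text \<open>On its domain \<open>edge_op 2\<close> is the sum of its three arguments modulo 2, and a
  sum of three tuples of odd weight has odd weight.\<close>

lemma odd_tuples_in_Inv_edge: "(n, odd_tuples n) \<in> Inv (edge_op 2)"
proof -
  have sv: "single_valued (edge_graph 2 :: (bool list \<times> bool) set)"
    by (intro single_valued_edge_graph) simp
  have "r \<in> odd_tuples n"
    if ts: "length ts = 2 + 1" "set ts \<subseteq> odd_tuples n" and r: "length r = n"
      "\<And>i. i < n \<Longrightarrow> (column ts i, r ! i) \<in> edge_graph 2" for ts r
  proof -
    obtain a b c where abc: "ts = [a, b, c]"
      using ts(1) by (auto simp: length_Suc_conv eval_nat_numeral)
    have even_iff: "even (of_bool P + of_bool Q + of_bool R + of_bool S :: nat) \<longleftrightarrow> ((P = Q) = (R = S))"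
      for P Q R S :: bool
      by simp
    have "even (of_bool (a ! i) + of_bool (b ! i) + of_bool (c ! i) + of_bool (r ! i) :: nat)"
      if "i < n" for i
      unfolding even_iff using r(2)[OF that]
      by (auto simp: abc column_def edge_graph_def numeral_2_eq_2)
    then have "even (\<Sum>i<n. of_bool (a ! i) + of_bool (b ! i) + of_bool (c ! i) + of_bool (r ! i) :: nat)"
      by (intro dvd_sum) auto
    then show ?thesis
      using ts(2) r(1) by (auto simp: abc sum.distrib odd_tuples_def)
  qed
  then show ?thesis
    unfolding edge_op_def Inv_graph_iff[OF sv] by (auto simp: odd_tuples_def)
qed

lemma odd_tuples_notin_Inv_nu:
  assumes "k \<ge> 3"
  shows "(k, odd_tuples k) \<notin> Inv (nu_op k)"
proof
  assume "(k, odd_tuples k) \<in> Inv (nu_op k)"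
  then have *: "\<And>ts r. length ts = k \<Longrightarrow> set ts \<subseteq> odd_tuples k \<Longrightarrow> length r = k \<Longrightarrow>
      (\<And>i. i < k \<Longrightarrow> (column ts i, r ! i) \<in> nu_graph k) \<Longrightarrow> r \<in> odd_tuples k"
    unfolding nu_op_def Inv_graph_iff[OF single_valued_nu_graph[OF assms]] by blast
  \<comment> \<open>The unit vectors have odd weight, and every column contains exactly one
    \<open>True\<close>, so near-unanimity returns the zero tuple.\<close>
  define ts where "ts = map (\<lambda>p. map (\<lambda>i. i = p) [0..<k]) [0..<k]"
  have "replicate k False \<in> odd_tuples k"
  proof (rule *)
    have "map (\<lambda>i. i = p) [0..<k] \<in> odd_tuples k" if "p < k" for p
    proof -
      have "(\<Sum>i<k. of_bool (map (\<lambda>i. i = p) [0..<k] ! i) :: nat) = (\<Sum>i<k. if i = p then 1 else 0)"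
        by (intro sum.cong) auto
      also have "\<dots> = 1" using that by simp
      finally show ?thesis unfolding odd_tuples_def mem_Collect_eq by (simp only:) simp
    qed
    then show "set ts \<subseteq> odd_tuples k"
      by (auto simp: ts_def)
    show "(column ts i, replicate k False ! i) \<in> nu_graph k" if "i < k" for i
      using that by (auto simp: ts_def column_def nu_graph_iff)
  qed (simp_all add: ts_def)
  moreover have "(\<Sum>i<k. of_bool (replicate k False ! i) :: nat) = 0"
    by (intro sum.neutral) auto
  ultimately show False unfolding odd_tuples_def mem_Collect_eq by (simp only:) simp
qed

section \<open>Separation of the universal from the edge operations\<close>

text \<open>The unit vectors together with the vector \<open>(1, 1, 0, \<dots>, 0)\<close>.\<close>

definition edge_tuples :: "nat \<Rightarrow> bool list set" where
  "edge_tuples k = {t. length t = k \<and> (\<exists>i<k. t ! i) \<and>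
     (\<forall>i<k. \<forall>j<k. i \<noteq> j \<and> t ! i \<and> t ! j \<longrightarrow> i < 2)}"

lemma edge_tuples_two_ones:
  assumes "t \<in> edge_tuples k" "i < k" "j < k" "i \<noteq> j" "t ! i" "t ! j"
  shows "i < 2"
  using assms unfolding edge_tuples_def by blast

lemma edge_tuples_notin_Inv_edge:
  assumes "k \<ge> 2"
  shows "(k, edge_tuples k) \<notin> Inv (edge_op k)"
proof
  assume "(k, edge_tuples k) \<in> Inv (edge_op k)"
  then have *: "\<And>ts r. length ts = k + 1 \<Longrightarrow> set ts \<subseteq> edge_tuples k \<Longrightarrow> length r = k \<Longrightarrow>
      (\<And>i. i < k \<Longrightarrow> (column ts i, r ! i) \<in> edge_graph k) \<Longrightarrow> r \<in> edge_tuples k"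
    unfolding edge_op_def Inv_graph_iff[OF single_valued_edge_graph[OF assms]] by blast
  \<comment> \<open>The rows are all \<open>k + 1\<close> members of the relation; column
    \<open>i\<close> is the edge pattern of index \<open>i\<close> with \<open>x = True\<close> and
    value \<open>False\<close>.\<close>
  define ts where
    "ts = map (\<lambda>p. map (\<lambda>i. p = 0 \<and> i < 2 \<or> p = i + 1) [0..<k]) [0..<k + 1]"
  have "replicate k False \<in> edge_tuples k"
  proof (rule *)
    have "map (\<lambda>i. p = 0 \<and> i < 2 \<or> p = i + 1) [0..<k] \<in> edge_tuples k" if "p < k + 1" for p
      using that assms by (auto simp: edge_tuples_def intro!: exI[of _ "p - 1"])
    then show "set ts \<subseteq> edge_tuples k"
      by (auto simp: ts_def simp del: upt_Suc)
    show "(column ts i, replicate k False ! i) \<in> edge_graph k" if "i < k" for i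
      using that unfolding edge_graph_iff[OF assms]
      by (auto simp: ts_def column_def intro!: exI[of _ True] exI[of _ i] simp del: upt_Suc)
  qed (simp_all add: ts_def)
  then show False by (auto simp: edge_tuples_def)
qed

text \<open>Once all nonconstant columns read one common coordinate \<open>j0\<close>, any row whose
  index vector is zero at \<open>j0\<close> coincides with the result, which therefore lies in the
  relation.\<close>

lemma edge_tuples_in_Inv_univ:
  assumes k: "k \<ge> 3"
  shows "(k, edge_tuples k) \<in> Inv (univ_op k)"
proof -
  have sv: "single_valued (univ_graph k)"
    using k by (intro single_valued_univ_graph) simp
  have "r \<in> edge_tuples k"
    if ts: "length ts = 2 ^ k - 1" "set ts \<subseteq> edge_tuples k" and r: "length r = k"
      "\<And>i. i < k \<Longrightarrow> (column ts i, r ! i) \<in> univ_graph k" for ts r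
  proof -
    define N :: nat where "N = 2 ^ k - 1"
    define V where "V p = nonzero_vectors k ! p" for p
    \<comment> \<open>Column \<open>i\<close> is the projection tuple of \<open>j\<close>,
      complemented if its value \<open>r ! i\<close> is \<open>True\<close>.\<close>
    define proj where "proj i j \<longleftrightarrow> (\<forall>p<N. (ts ! p ! i \<longleftrightarrow> V p ! j \<noteq> r ! i))" for i j
    have mem: "ts ! p \<in> edge_tuples k" if "p < N" for p
      using that ts by (auto simp: N_def)
    have cols: "(\<forall>p<N. ts ! p ! i = r ! i) \<or> (\<exists>j<k. proj i j)" if "i < k" for i
      using r(2)[OF that]
    proof (cases rule: univ_graph_cases)
      case const
      have "ts ! p ! i = r ! i" if "p < N" for p
        using that ts(1) arg_cong[OF const, of "\<lambda>t. t ! p"]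
        by (simp add: column_def N_def)
      then show ?thesis by blast
    next
      case (proj b j)
      have "ts ! p ! i \<longleftrightarrow> V p ! j \<noteq> r ! i" if "p < N" for p
        using that ts(1) proj(2) arg_cong[OF proj(3), of "\<lambda>t. t ! p"]
        by (simp add: column_def N_def V_def nonzero_vectors)
      then show ?thesis using proj(1) unfolding proj_def by blast
    qed
    \<comment> \<open>A third coordinate, available as \<open>k \<ge> 3\<close>, stays
      \<open>True\<close> and keeps the vector nonzero.\<close>
    have pos: "\<exists>p<N. V p ! j = a \<and> V p ! j' = b" if "j < k" "j' < k" "j = j' \<Longrightarrow> a = b" for j j' a b
    proof -
      have "\<not> {0, 1, 2} \<subseteq> {j, j'}" by auto
      then obtain l where "l < k" "l \<noteq> j" "l \<noteq> j'" using k by force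
      moreover define v where "v = (replicate k True)[j := a, j' := b]"
      ultimately have "length v = k" "l < k" "v ! l" "v ! j = a" "v ! j' = b"
        using that by (auto simp: nth_list_update)
      then show ?thesis using nonzero_vector_position[of v k l] by (metis N_def V_def)
    qed
    have all_pairs: "\<exists>p<N. ts ! p ! i = a \<and> ts ! p ! i' = b"
      if ij: "proj i j" "proj i' j'" "j < k" "j' < k" "j \<noteq> j'" for i i' j j' a b
    proof -
      obtain p where "p < N" "V p ! j = (a \<noteq> r ! i)" "V p ! j' = (b \<noteq> r ! i')"
        using pos[OF ij(3,4), of "a \<noteq> r ! i" "b \<noteq> r ! i'"] ij(5) by auto
      then show ?thesis using ij(1,2) unfolding proj_def by (intro exI[of _ p]) auto
    qed
    \<comment> \<open>Some row has ones at both \<open>i\<close> and \<open>i'\<close>, which the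
      relation allows only among the first two coordinates.\<close>
    have small: "i < 2"
      if ij: "proj i j" "proj i' j'" "j < k" "j' < k" "j \<noteq> j'" "i < k" "i' < k" "i \<noteq> i'" for i i' j j'
    proof -
      obtain p where "p < N" "ts ! p ! i" "ts ! p ! i'"
        using all_pairs[OF ij(1-5), of True True] by blast
      then show ?thesis using edge_tuples_two_ones[OF mem ij(6-8)] by blast
    qed
    have same: "j = j'" if ij: "proj i j" "proj i' j'" "j < k" "j' < k" "i < k" "i' < k" for i i' j j'
    proof (rule ccontr)
      assume ne: "j \<noteq> j'"
      have "i \<noteq> i'"
        using all_pairs[OF ij(1-4) ne, of True False] by auto
      then have i: "i < 2" "i' < 2"
        using small[OF ij(1-4) ne ij(5,6)] small[OF ij(2,1,4,3) ne[symmetric] ij(6,5)] by simp_all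
      obtain p where p: "p < N" "\<not> ts ! p ! i" "\<not> ts ! p ! i'"
        using all_pairs[OF ij(1-4) ne, of False False] by blast
      obtain q where q: "q < N" "ts ! q ! i" "ts ! q ! i'"
        using all_pairs[OF ij(1-4) ne, of True True] by blast
      \<comment> \<open>As \<open>i\<close> and \<open>i'\<close> are 0 and 1, row \<open>p\<close>
        has its one at some \<open>m \<ge> 2\<close>, while row \<open>q\<close> is zero there.
        Hence column \<open>m\<close> is not constant and reads some coordinate
        \<open>l\<close>.\<close>
      obtain m where m: "m < k" "ts ! p ! m"
        using mem[OF p(1)] unfolding edge_tuples_def by blast
      have m2: "m \<ge> 2" using i \<open>i \<noteq> i'\<close> m(2) p(2,3) by (metis less_2_cases not_le)
      then have "m \<noteq> i" "m \<noteq> i'" using i by auto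
      then have "\<not> ts ! q ! m"
        using edge_tuples_two_ones[OF mem[OF q(1)] m(1) ij(5)] q(2) m2 by auto
      then obtain l where l: "l < k" "proj m l"
        using cols[OF m(1)] m(2) p(1) q(1) by blast
      \<comment> \<open>\<open>l\<close> differs from \<open>j\<close> or from \<open>j'\<close>;
        pairing column \<open>m\<close> with the corresponding column forces
        \<open>m < 2\<close>.\<close>
      have "m < 2"
      proof (cases "l = j")
        case True
        then show ?thesis
          using small[OF l(2) ij(2) l(1) ij(4) _ m(1) ij(6) \<open>m \<noteq> i'\<close>] ne by simp
      next
        case False
        then show ?thesis
          using small[OF l(2) ij(1) l(1) ij(3) _ m(1) ij(5) \<open>m \<noteq> i\<close>] by simp
      qed
      then show False using m2 by simp
    qed
    have "\<exists>j0<k. \<forall>i<k. \<forall>j<k. proj i j \<longrightarrow> j = j0"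
    proof (cases "\<exists>i<k. \<exists>j<k. proj i j")
      case True
      then show ?thesis using same by metis
    next
      case False
      then show ?thesis using k by (intro exI[of _ 0]) auto
    qed
    then obtain j0 where j0: "j0 < k" "\<And>i j. i < k \<Longrightarrow> j < k \<Longrightarrow> proj i j \<Longrightarrow> j = j0" by blast
    \<comment> \<open>At such a row a column reading \<open>j0\<close> shows exactly its value
      \<open>r ! i\<close>, and constant columns do so at every row.\<close>
    obtain p where p: "p < N" "\<not> V p ! j0"
      using pos[OF j0(1) j0(1), of False False] by auto
    have "ts ! p ! i = r ! i" if "i < k" for i
      using cols[OF that] j0(2)[OF that] p unfolding proj_def by blast
    then have "r = ts ! p"
      using r(1) mem[OF p(1)] by (auto simp: edge_tuples_def list_eq_iff_nth_eq)
    then show ?thesis using mem[OF p(1)] by simp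
  qed
  then show ?thesis
    unfolding univ_op_def Inv_graph_iff[OF sv] by (auto simp: edge_tuples_def)
qed

section \<open>Assembly of the strict inclusions\<close>

theorem theorem9:
  fixes k :: nat
  assumes "k \<ge> 3"
  shows "Inv (edge_op 2 :: bool partial_op) \<subset> Inv (edge_op k)
    \<and> (Inv (nu_op k :: bool partial_op) \<subset> Inv (edge_op k)
        \<and> Inv (edge_op k) \<subset> Inv (univ_op k))
    \<and> Inv (nu_op k :: bool partial_op) \<subset> Inv (nu_op (k + 1))
    \<and> Inv (edge_op k :: bool partial_op) \<subset> Inv (edge_op (k + 1))
    \<and> Inv (univ_op k) \<subset> Inv (univ_op (k + 1))"
proof (intro conjI)
  \<comment> \<open>Membership for near-unanimity propagates upwards along the inclusions at
    \<open>l + 1\<close>; non-membership for the universal operation propagates down to the edge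
    operation at \<open>l\<close>.\<close>
  have in_nu: "(l, nonzero_tuples l) \<in> Inv (nu_op (l + 1))"
    and in_edge: "(l, nonzero_tuples l) \<in> Inv (edge_op (l + 1))"
    and in_univ: "(l, nonzero_tuples l) \<in> Inv (univ_op (l + 1))"
    and notin_univ: "(l, nonzero_tuples l) \<notin> Inv (univ_op l)"
    and notin_edge: "(l, nonzero_tuples l) \<notin> Inv (edge_op l)"
    if "l \<ge> 2" for l
    using that nonzero_tuples_in_Inv_nu[of l] nonzero_tuples_notin_Inv_univ[of l]
      Inv_nu_subset_Inv_edge[of "l + 1", where ?'a = bool]
      Inv_edge_subset_Inv_univ[of l] Inv_edge_subset_Inv_univ[of "l + 1"]
    by auto
  have k2: "k \<ge> 2" using assms by simp
  have nu_edge: "Inv (nu_op k :: bool partial_op) \<subseteq> Inv (edge_op k)"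
    using Inv_nu_subset_Inv_edge[OF assms] .
  have "Inv (edge_op 3 :: bool partial_op) \<subseteq> Inv (edge_op k)"
    "Inv (edge_op 2 :: bool partial_op) \<subseteq> Inv (edge_op k)"
    using Inv_edge_mono[of 3 k] Inv_edge_mono[of 2 k] assms by simp_all
  \<comment> \<open>The nonzero pairs already separate \<open>edge_op 2\<close> from
    \<open>edge_op 3\<close>, and \<open>k \<ge> 3\<close>.\<close>
  then show "Inv (edge_op 2 :: bool partial_op) \<subset> Inv (edge_op k)"
    using in_edge[of 2] notin_edge[of 2] by auto
  show "Inv (nu_op k :: bool partial_op) \<subset> Inv (edge_op k)"
    using nu_edge odd_tuples_notin_Inv_nu[OF assms] odd_tuples_in_Inv_edge[of k]
      Inv_edge_mono[of 2 k, where ?'a = bool] k2 by blast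
  show "Inv (edge_op k) \<subset> Inv (univ_op k)"
    using Inv_edge_subset_Inv_univ[OF k2] edge_tuples_in_Inv_univ[OF assms]
      edge_tuples_notin_Inv_edge[OF k2] by blast
  show "Inv (nu_op k :: bool partial_op) \<subset> Inv (nu_op (k + 1))"
    using Inv_nu_subset_Inv_nu_Suc[OF assms, where ?'a = bool] nu_edge in_nu[OF k2]
      notin_edge[OF k2] by blast
  show "Inv (edge_op k :: bool partial_op) \<subset> Inv (edge_op (k + 1))"
    using Inv_edge_subset_Inv_edge_Suc[OF k2, where ?'a = bool] in_edge[OF k2]
      notin_edge[OF k2] by blast
  show "Inv (univ_op k) \<subset> Inv (univ_op (k + 1))"
    using Inv_univ_subset_Inv_univ_Suc[OF k2] in_univ[OF k2] notin_univ[OF k2] by blast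
qed

end
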